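(* Let $X$ be a $\sigma$-compact topological space, $\lambda$ a Borel probability measure on $X$, and $f:X\to X$ a Borel measurable map with $f_*\lambda\ll\lambda$ which is ergodic conservative with respect to $\lambda$. Suppose the Radon–Nikodym derivatives of the measures $f^n_*\lambda$ have locally bounded distortion, in the following sense: there exists a $\lambda$-partition $\mathcal G$ of $X$ such that for every $I\in\mathcal G$ there is a constant $K>0$ such that for all $n\ge 0$, $0<\lambda(f^{-n}(I))<\infty$ and for every measurable $A\subset I$ $$\frac1K\,\frac{\lambda(A)}{\lambda(I)}\le\frac{\lambda(f^{-n}(A))}{\lambda(f^{-n}(I))}\le K\,\frac{\lambda(A)}{\lambda(I)} .$$ Then $f$ has a nonzero $\sigma$-finite invariant Borel measure which is absolutely continuous with respect to $\lambda$.
   Context: A measure $\mu$ is invariant for $f$ if $f_*\mu=\mu$, where $f_*\mu(A)=\mu(f^{-1}(A))$. A Borel measure is $\sigma$-finite if, up to a set of measure zero, $X$ is a countable disjoint union of measurable sets of finite measure. $f$ is ergodic conservative with respect to $\lambda$ if for every measurable set $A$ with $\lambda(A)>0$, for $\lambda$-almost every $x$ there is $n\ge1$ with $f^n(x)\in A$. A $\lambda$-partition $\mathcal G$ of $X$ is a countable collection of pairwise disjoint Borel subsets of $X$ such that each $I\in\mathcal G$ is $\sigma$-compact, $0<\lambda(I)<\infty$ for each $I\in\mathcal G$, and $\lambda(X\setminus\bigcup_{I\in\mathcal G}I)=0$. *)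

theory Defs
  imports "HOL-Probability.Probability"
begin

definition sigma_compact :: "'a::topological_space set \<Rightarrow> bool" where
  "sigma_compact S \<longleftrightarrow> (\<exists>\<C>. countable \<C> \<and> (\<forall>C\<in>\<C>. compact C) \<and> S = \<Union>\<C>)"

definition invariant_measure :: "('a \<Rightarrow> 'a) \<Rightarrow> 'a measure \<Rightarrow> bool" where
  "invariant_measure f M \<longleftrightarrow> f \<in> M \<rightarrow>\<^sub>M M \<and> distr M M f = M"

definition ergodic_conservative :: "('a \<Rightarrow> 'a) \<Rightarrow> 'a measure \<Rightarrow> bool" where
  "ergodic_conservative f M \<longleftrightarrow>
     (\<forall>A\<in>sets M. emeasure M A > 0 \<longrightarrow> (AE x in M. \<exists>n\<ge>1. (f ^^ n) x \<in> A))"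

definition measure_partition :: "'a::topological_space measure \<Rightarrow> 'a set set \<Rightarrow> bool" where
  "measure_partition M \<G> \<longleftrightarrow>
     countable \<G> \<and> disjoint \<G> \<and>
     (\<forall>I\<in>\<G>. I \<in> sets borel \<and> sigma_compact I \<and> 0 < emeasure M I \<and> emeasure M I < \<infinity>) \<and>
     emeasure M (space M - \<Union>\<G>) = 0"

text \<open>All measures occurring in the quotients are required to be positive and finite, apart from
  those of \<open>A\<close> and its preimages, which are bounded by them; so the real-valued \<^const>\<open>measure\<close>
  agrees with \<^const>\<open>emeasure\<close> there and no division by zero occurs.\<close>

definition locally_bounded_distortion ::
    "('a::topological_space \<Rightarrow> 'a) \<Rightarrow> 'a measure \<Rightarrow> bool" where
  "locally_bounded_distortion f M \<longleftrightarrow>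
     (\<exists>\<G>. measure_partition M \<G> \<and>
       (\<forall>I\<in>\<G>. \<exists>K::real. K > 0 \<and>
         (\<forall>n::nat.
            0 < emeasure M ((f ^^ n) -` I \<inter> space M) \<and>
            emeasure M ((f ^^ n) -` I \<inter> space M) < \<infinity> \<and>
            (\<forall>A\<in>sets M. A \<subseteq> I \<longrightarrow>
               1 / K * (measure M A / measure M I)
                 \<le> measure M ((f ^^ n) -` A \<inter> space M) / measure M ((f ^^ n) -` I \<inter> space M) \<and>
               measure M ((f ^^ n) -` A \<inter> space M) / measure M ((f ^^ n) -` I \<inter> space M)
                 \<le> K * (measure M A / measure M I)))))"

end

theory Submission
  imports Defs
begin

text \<open>Fix an element \<open>I\<close> of the partition and let \<open>u n A\<close> be the sum of \<open>\<lambda>(f\<^sup>-\<^sup>k A)\<close> over \<open>k < n\<close>, divided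
  by the same sum for \<open>I\<close>. Recurrence makes the denominators tend to infinity, and bounded distortion
  together with recurrence to \<open>I\<close> gives \<open>u n A \<le> C \<lambda>(A)\<close> for \<open>A \<subseteq> J\<close>, with \<open>C\<close> depending only on the
  partition element \<open>J\<close>. Tychonoff's theorem provides a filter along which \<open>u n A\<close> converges for all such
  \<open>A\<close> at once; the domination makes the limit countably additive on each \<open>J\<close>, so no densities or weak
  compactness are needed. The sum \<open>\<mu>\<close> over all \<open>J\<close> of these limits satisfies \<open>\<mu>(f\<^sup>-\<^sup>1 A) \<le> \<mu>(A)\<close> only, since
  mass may escape in the limit. But the defect measure \<open>\<nu> = \<mu> - f\<^sub>*\<mu>\<close> gives the sets \<open>f\<^sup>-\<^sup>n I\<close> total mass at
  most \<open>\<mu>(I)\<close>, whereas almost every point lies in infinitely many of them; so \<open>\<nu> = 0\<close> by Borel--Cantelli.\<close>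

section \<open>Limits along filters and countable additivity\<close>

text \<open>The bounds confine the sequence to a product of compact intervals, which is compact by
  Tychonoff, and \<open>F\<close> follows a cluster point \<open>L\<close>. A filter is used because
  \<open>S\<close> may be uncountable, so that a diagonal subsequence need not serve all of its
  elements at once.\<close>

lemma pointwise_limit_along_finer_filter:
  fixes u :: "nat \<Rightarrow> 'b \<Rightarrow> real"
  assumes bdd: "\<And>a. a \<in> S \<Longrightarrow> bounded (range (\<lambda>n. u n a))"
  obtains F L where "F \<noteq> bot" "F \<le> sequentially"
    "\<And>a. a \<in> S \<Longrightarrow> ((\<lambda>n. u n a) \<longlongrightarrow> L a) F"
proof -
  \<comment> \<open>The value 0 outside \<open>S\<close> makes every coordinate bounded, so the
    compact product runs over the whole index type.\<close>
  define v where "v n a = (if a \<in> S then u n a else 0)" for n a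
  have "\<exists>c. \<forall>n. \<bar>v n a\<bar> \<le> c" for a
    using bdd[of a] by (auto simp: v_def bounded_iff)
  then obtain c where c: "\<And>a n. \<bar>v n a\<bar> \<le> c a"
    by metis
  define U where "U = (\<Pi>\<^sub>E a\<in>UNIV. {- c a..c a})"
  have "compactin (product_topology (\<lambda>_. euclidean) UNIV) U"
    unfolding U_def by (subst compactin_PiE) auto
  then have "compact U"
    by (simp add: euclidean_product_topology)
  moreover have "v n \<in> U" for n
    using c[of n] by (auto simp: U_def abs_le_iff minus_le_iff)
  ultimately obtain L where L: "inf (nhds L) (filtermap v sequentially) \<noteq> bot"
    unfolding compact_filter
    by (metis (mono_tags, lifting) always_eventually eventually_filtermap filtermap_bot_iff
        sequentially_bot)
  \<comment> \<open>Pulling the neighbourhoods of \<open>L\<close> back to the indices forces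
    \<open>v\<close> to tend to \<open>L\<close>; meeting them with \<open>sequentially\<close>
    keeps every limit that exists along \<open>sequentially\<close>.\<close>
  define F where "F = inf (filtercomap v (nhds L)) sequentially"
  show thesis
  proof
    show "F \<noteq> bot"
    proof
      assume "F = bot"
      then obtain P Q where "eventually P (nhds L)" "eventually Q sequentially"
        and PQ: "\<And>n. P (v n) \<Longrightarrow> Q n \<Longrightarrow> False"
        unfolding trivial_limit_def F_def eventually_inf eventually_filtercomap by blast
      \<comment> \<open>If \<open>F\<close> were trivial, the negation of \<open>P\<close> would
        hold eventually along the sequence, separating it from the cluster point
        \<open>L\<close>.\<close>
      then have "\<exists>P Q. eventually P (nhds L) \<and> eventually Q (filtermap v sequentially) \<and>
          (\<forall>y. P y \<and> Q y \<longrightarrow> False)"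
        by (intro exI[of _ P] exI[of _ "\<lambda>y. \<not> P y"])
           (auto simp: eventually_filtermap elim!: eventually_mono)
      then show False
        using L by (simp add: trivial_limit_def eventually_inf)
    qed
    show "F \<le> sequentially"
      by (simp add: F_def)
    have "filterlim v (nhds L) F"
      unfolding F_def by (metis filterlim_filtercomap filterlim_mono inf_le1 order_refl)
    moreover have "((\<lambda>g. g a) \<longlongrightarrow> L a) (nhds L)" for a
    proof (rule topological_tendstoI)
      fix B :: "real set" assume "open B" "L a \<in> B"
      moreover have "open ((\<lambda>g::'b \<Rightarrow> real. g a) -` B)"
        using \<open>open B\<close> continuous_on_product_coordinates by (rule open_vimage)
      ultimately show "\<forall>\<^sub>F g in nhds L. g a \<in> B"
        unfolding eventually_nhds by blast
    qed
    ultimately have lim: "((\<lambda>n. v n a) \<longlongrightarrow> L a) F" for a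
      by (rule filterlim_compose[rotated])
    show "((\<lambda>n. u n a) \<longlongrightarrow> L a) F" if "a \<in> S" for a
      using lim[of a] that by (simp add: v_def)
  qed
qed

text \<open>For a nonnegative finite additive set function, countable additivity follows from
  continuity at the empty set; here the values along a decreasing sequence are squeezed between 0
  and multiples of measures that tend to 0.\<close>

lemma (in finite_measure) countably_additive_if_dominated:
  fixes L :: "'a set \<Rightarrow> real"
  assumes nonneg: "\<And>A. A \<in> sets M \<Longrightarrow> 0 \<le> L A"
    and add: "\<And>A B. A \<in> sets M \<Longrightarrow> B \<in> sets M \<Longrightarrow> A \<inter> B = {} \<Longrightarrow> L (A \<union> B) = L A + L B"
    and dom: "\<And>A. A \<in> sets M \<Longrightarrow> L A \<le> C * measure M A"
  shows "countably_additive (sets M) (\<lambda>A. ennreal (L A))"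
proof (rule sets.empty_continuous_imp_countably_additive)
  have "L {} = 0"
    using add[of "{}" "{}"] by simp
  then show "positive (sets M) (\<lambda>A. ennreal (L A))"
    by (simp add: positive_def)
  show "additive (sets M) (\<lambda>A. ennreal (L A))"
    by (auto simp: additive_def add nonneg)
  show "\<forall>A\<in>sets M. ennreal (L A) \<noteq> \<infinity>"
    by simp
  fix A :: "nat \<Rightarrow> 'a set"
  assume A: "range A \<subseteq> sets M" "decseq A" "(\<Inter>i. A i) = {}"
  have "(\<lambda>i. C * measure M (A i)) \<longlonglongrightarrow> C * measure M (\<Inter>i. A i)"
    by (intro tendsto_intros finite_Lim_measure_decseq A)
  then have "(\<lambda>i. C * measure M (A i)) \<longlonglongrightarrow> 0"
    using A by simp
  then have "(\<lambda>i. L (A i)) \<longlonglongrightarrow> 0"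
    using A by (intro tendsto_sandwich[OF _ _ tendsto_const \<open>_ \<longlonglongrightarrow> 0\<close>])
      (auto intro!: always_eventually nonneg dom)
  then show "(\<lambda>i. ennreal (L (A i))) \<longlonglongrightarrow> 0"
    using tendsto_ennrealI by fastforce
qed

section \<open>Recurrence and Borel-Cantelli\<close>

text \<open>Absolute continuity lets almost sure statements be pulled back along \<open>f\<close>: a
  visit of \<open>f x\<close> at some time at least \<open>N\<close> is a visit of \<open>x\<close>
  at some time at least \<open>N + 1\<close>. Countably many such statements hold together.\<close>

lemma AE_frequently_visits:
  assumes f: "f \<in> M \<rightarrow>\<^sub>M M" and ac: "absolutely_continuous M (distr M M f)"
    and ec: "ergodic_conservative f M" and A: "A \<in> sets M" "emeasure M A > 0"
  shows "AE x in M. \<exists>\<^sub>F n in sequentially. (f ^^ n) x \<in> A"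
proof -
  have shift: "AE x in M. P (f x)" if "AE x in M. P x" for P
    using absolutely_continuous_AE[OF _ ac that] f by (intro AE_distrD[OF f]) simp
  have "AE x in M. \<exists>n\<ge>N. (f ^^ n) x \<in> A" for N
  proof (induction N)
    case 0
    show ?case
      using ec A unfolding ergodic_conservative_def by (auto elim!: eventually_mono)
  next
    case (Suc N)
    show ?case
      using shift[OF Suc]
    proof eventually_elim
      case (elim x)
      then obtain n where "n \<ge> N" "(f ^^ n) (f x) \<in> A"
        by auto
      then show ?case
        by (intro exI[of _ "Suc n"]) (simp add: funpow_swap1)
    qed
  qed
  then show ?thesis
    by (simp add: frequently_sequentially AE_all_countable)
qed

text \<open>The contrapositive of the first Borel-Cantelli lemma. It is applied both to the
  reference measure, to make the denominators diverge, and to a defect measure, to show that it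
  vanishes.\<close>

lemma not_summable_if_AE_frequently:
  assumes "finite_measure M" and E: "\<And>n. E n \<in> sets M"
    and freq: "AE x in M. \<exists>\<^sub>F n in sequentially. x \<in> E n"
    and pos: "emeasure M (space M) \<noteq> 0"
  shows "\<not> summable (\<lambda>n::nat. measure M (E n))"
proof
  interpret finite_measure M by fact
  assume "summable (\<lambda>n. measure M (E n))"
  then have "AE x in M. eventually (\<lambda>n. x \<in> space M - E n) sequentially"
    by (intro borel_cantelli_AE1) (auto simp: E emeasure_eq_measure)
  with freq have "AE x in M. False"
  proof eventually_elim
    case (elim x)
    then have "\<exists>\<^sub>F n in sequentially. x \<in> space M - E n \<and> x \<in> E n"
      by (rule frequently_eventually_conj)
    then show False
      by simp
  qed
  then show False
    using pos by (simp add: AE_iff_measurable[OF sets.top])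
qed

section \<open>From subinvariance to invariance\<close>

text \<open>The defect charges the iterated preimages of \<open>I\<close> by a telescoping, hence
  summable, amount, although almost every point lies in infinitely many of them. The argument runs
  inside sets of finite measure, where the defect is a genuine measure; sigma-finiteness then gives
  the rest.\<close>

lemma subinvariant_imp_invariant:
  assumes "sigma_finite_measure \<mu>" and sets: "sets \<mu> = sets M"
    and f: "f \<in> M \<rightarrow>\<^sub>M M" and ac: "absolutely_continuous M (distr M M f)"
    and ec: "ergodic_conservative f M" and ac': "absolutely_continuous M \<mu>"
    and sub: "\<And>A. A \<in> sets M \<Longrightarrow> emeasure \<mu> (f -` A \<inter> space M) \<le> emeasure \<mu> A"
    and I: "I \<in> sets M" "emeasure M I > 0" "emeasure \<mu> I < \<infinity>"
  shows "distr \<mu> \<mu> f = \<mu>"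
proof -
  interpret sigma_finite_measure \<mu> by fact
  have sp: "space \<mu> = space M"
    using sets by (rule sets_eq_imp_space_eq)
  have f': "f \<in> \<mu> \<rightarrow>\<^sub>M \<mu>"
    using f measurable_cong_sets[OF sets sets] by simp
  define T where "T = distr \<mu> \<mu> f"
  have sets_T [simp]: "sets T = sets M" and sp_T: "space T = space M"
    by (simp_all add: T_def sets sp)
  have T: "emeasure T A = emeasure \<mu> (f -` A \<inter> space M)" if "A \<in> sets M" for A
    using that f' by (simp add: T_def emeasure_distr sets sp)
  have T_le: "emeasure T A \<le> emeasure \<mu> A" if "A \<in> sets M" for A
    using sub that by (simp add: T)
  define E where "E n = (f ^^ n) -` I \<inter> space M" for n
  have fn: "f ^^ n \<in> M \<rightarrow>\<^sub>M M" for n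
    using f by (rule measurable_compose_n)
  have E: "E n \<in> sets M" for n
    unfolding E_def using fn I(1) by (rule measurable_sets)
  have T_E: "emeasure T (E n) = emeasure \<mu> (E (Suc n))" for n
    using E measurable_space[OF f]
    by (auto simp: T E_def funpow_swap1 intro!: arg_cong[where f="emeasure \<mu>"])
  \<comment> \<open>Finiteness propagates from \<open>I\<close> by subinvariance; it allows the
    later telescoping to take place in the reals.\<close>
  have fin_E: "emeasure \<mu> (E n) < \<infinity>" for n
  proof (induction n)
    case 0
    show ?case
      using I sets.sets_into_space by (simp add: E_def Int_absorb2)
  next
    case (Suc n)
    then show ?case
      using T_le[OF E, of n] by (simp add: T_E le_less_trans)
  qed
  have eq: "emeasure T B = emeasure \<mu> B" if B: "B \<in> sets M" "emeasure \<mu> B < \<infinity>" for B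
  proof -
    \<comment> \<open>Restricting both measures to \<open>B\<close> makes them finite, so that their
      difference \<open>\<nu>\<close> can be formed as a measure.\<close>
    define \<alpha> where "\<alpha> = density \<mu> (indicator B)"
    define \<beta> where "\<beta> = density T (indicator B)"
    have ind: "indicator B \<in> borel_measurable \<mu>" "indicator B \<in> borel_measurable T"
      using B by (auto intro!: borel_measurable_indicator simp: sets)
    have \<alpha>: "emeasure \<alpha> A = emeasure \<mu> (B \<inter> A)" if "A \<in> sets M" for A
      unfolding \<alpha>_def using that B by (subst emeasure_density[OF ind(1)])
        (auto simp: sets indicator_inter_arith[symmetric])
    have \<beta>: "emeasure \<beta> A = emeasure T (B \<inter> A)" if "A \<in> sets M" for A
      unfolding \<beta>_def using that B by (subst emeasure_density[OF ind(2)])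
        (auto simp: sets indicator_inter_arith[symmetric])
    have sets_ab: "sets \<alpha> = sets M" "sets \<beta> = sets M" "space \<alpha> = space M" "space \<beta> = space M"
      by (simp_all add: \<alpha>_def \<beta>_def sets sp sp_T)
    have B_sp: "B \<inter> space M = B"
      using B sets.sets_into_space by auto
    have fin: "finite_measure \<alpha>" "finite_measure \<beta>"
      using B le_less_trans[OF T_le B(2)]
      by (auto intro!: finite_measureI simp: sets_ab \<alpha> \<beta> B_sp less_top)
    define \<nu> where "\<nu> = diff_measure \<alpha> \<beta>"
    have \<nu>: "emeasure \<nu> A = emeasure \<mu> (B \<inter> A) - emeasure T (B \<inter> A)" if "A \<in> sets M" for A
      unfolding \<nu>_def using that B
      by (subst emeasure_diff_measure[OF fin]) (auto simp: sets_ab \<alpha> \<beta> T_le)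
    have sets_\<nu>: "sets \<nu> = sets M" and sp_\<nu>: "space \<nu> = space M"
      by (simp_all add: \<nu>_def sets_ab)
    have "finite_measure \<nu>"
      using B by (auto intro!: finite_measureI simp: sp_\<nu> \<nu> B_sp)
    then interpret \<nu>: finite_measure \<nu> .
    have defect: "measure \<nu> (E n) \<le> measure \<mu> (E n) - measure \<mu> (E (Suc n))" for n
    proof -
      \<comment> \<open>Inside \<open>B\<close> the defect is the exact difference; outside
        \<open>B\<close> the bound of \<open>T\<close> by \<open>\<mu>\<close> already has the right
        direction.\<close>
      let ?X = "B \<inter> E n" and ?Y = "E n - B"
      have XY: "?X \<in> sets M" "?Y \<in> sets M" "?X \<union> ?Y = E n" "?X \<inter> ?Y = {}"
        using B E by auto
      have le: "emeasure T ?X \<le> emeasure \<mu> ?X"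
        by (rule T_le) (rule XY)
      have "emeasure \<nu> (E n) + emeasure \<mu> (E (Suc n)) =
          (emeasure \<mu> ?X - emeasure T ?X) + (emeasure T ?X + emeasure T ?Y)"
        unfolding T_E[symmetric] \<nu>[OF E] using XY by (subst plus_emeasure) auto
      also have "\<dots> = emeasure \<mu> ?X + emeasure T ?Y"
        using le by (simp add: add.assoc[symmetric] diff_add_cancel_ennreal)
      also have "\<dots> \<le> emeasure \<mu> ?X + emeasure \<mu> ?Y"
        by (intro add_left_mono T_le XY)
      also have "\<dots> = emeasure \<mu> (E n)"
        using XY by (subst plus_emeasure) (auto simp: sets)
      finally have "ennreal (measure \<nu> (E n) + measure \<mu> (E (Suc n))) \<le> ennreal (measure \<mu> (E n))"
        using fin_E by (simp add: \<nu>.emeasure_eq_measure emeasure_eq_ennreal_measure less_top)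
      then show ?thesis
        by (subst (asm) ennreal_le_iff) auto
    qed
    have "(\<Sum>k<n. measure \<nu> (E k)) \<le> measure \<mu> (E 0)" for n
    proof -
      have "(\<Sum>k<n. measure \<nu> (E k)) \<le> (\<Sum>k<n. measure \<mu> (E k) - measure \<mu> (E (Suc k)))"
        by (intro sum_mono defect)
      also have "\<dots> = measure \<mu> (E 0) - measure \<mu> (E n)"
        by (rule sum_lessThan_telescope')
      finally show ?thesis
        using measure_nonneg[of \<mu> "E n"] by linarith
    qed
    then have "summable (\<lambda>n. measure \<nu> (E n))"
      by (intro summableI_nonneg_bounded) auto
    moreover have "AE x in \<nu>. \<exists>\<^sub>F n in sequentially. x \<in> E n"
    proof -
      \<comment> \<open>Recurrence holds almost everywhere for \<open>M\<close> and is carried over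
        to \<open>\<nu>\<close>, which is dominated by \<open>\<mu>\<close> and so vanishes on null
        sets of \<open>M\<close>.\<close>
      have "absolutely_continuous M \<nu>"
        unfolding absolutely_continuous_def
      proof
        fix N assume N: "N \<in> null_sets M"
        then have "B \<inter> N \<in> null_sets M"
          using B by (intro null_set_Int1)
        then have "emeasure \<mu> (B \<inter> N) = 0"
          using ac' by (auto simp: absolutely_continuous_def)
        then show "N \<in> null_sets \<nu>"
          using N by (auto simp: null_sets_def sets_\<nu> \<nu>)
      qed
      with AE_frequently_visits[OF f ac ec I(1,2)]
      have "AE x in \<nu>. \<exists>\<^sub>F n in sequentially. (f ^^ n) x \<in> I"
        by (intro absolutely_continuous_AE[OF sets_\<nu>])
      with AE_space show ?thesis
        by eventually_elim (simp add: E_def sp_\<nu>)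
    qed
    ultimately have "emeasure \<nu> (space \<nu>) = 0"
      using not_summable_if_AE_frequently[of \<nu> E] E \<nu>.finite_measure_axioms sets_\<nu> by blast
    then have "emeasure \<mu> B - emeasure T B = 0"
      by (simp add: sp_\<nu> \<nu> B_sp)
    then show ?thesis
      using T_le[OF B(1)] B(2) by (metis antisym diff_eq_0_iff_ennreal)
  qed
  \<comment> \<open>Cutting along disjoint sets of finite measure extends the equality to all
    measurable sets.\<close>
  obtain D where D: "range D \<subseteq> sets \<mu>" "(\<Union>i. D i) = space \<mu>" "\<And>i::nat. emeasure \<mu> (D i) \<noteq> \<infinity>"
      "disjoint_family D"
    using sigma_finite_disjoint by blast
  have "emeasure T A = emeasure \<mu> A" if A: "A \<in> sets M" for A
  proof -
    have A_eq: "A = (\<Union>i. A \<inter> D i)"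
      using D(2) sp sets.sets_into_space[OF A] by auto
    have AD: "A \<inter> D i \<in> sets M" for i
      using A D(1) sets by auto
    have dj: "disjoint_family (\<lambda>i. A \<inter> D i)"
      using D(4) by (auto simp: disjoint_family_on_def)
    have "emeasure \<mu> (A \<inter> D i) < \<infinity>" for i
      using D(3)[of i] D(1) emeasure_mono[of "A \<inter> D i" "D i" \<mu>]
      by (metis inf_le2 infinity_ennreal_def le_less_trans less_top range_subsetD)
    then have "(\<Sum>i. emeasure T (A \<inter> D i)) = (\<Sum>i. emeasure \<mu> (A \<inter> D i))"
      using eq AD by simp
    moreover have "(\<Sum>i. emeasure T (A \<inter> D i)) = emeasure T (\<Union>i. A \<inter> D i)"
      using AD dj by (intro suminf_emeasure) auto
    moreover have "(\<Sum>i. emeasure \<mu> (A \<inter> D i)) = emeasure \<mu> (\<Union>i. A \<inter> D i)"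
      using AD dj by (intro suminf_emeasure) (auto simp: sets)
    ultimately show ?thesis
      using A_eq by simp
  qed
  then show ?thesis
    unfolding T_def by (intro measure_eqI) (auto simp: sets)
qed

section \<open>Construction of the measure from normalised averages\<close>

text \<open>Domination on each piece is the form in which bounded distortion enters: it provides the
  limits of the averages, their countable additivity and their absolute continuity. The set
  \<open>I\<close> fixes the normalisation, and recurrence removes the defect of
  subinvariance.\<close>

lemma invariant_measure_if_dominated_averages:
  assumes "prob_space M"
    and f: "f \<in> M \<rightarrow>\<^sub>M M" and ac: "absolutely_continuous M (distr M M f)"
    and ec: "ergodic_conservative f M"
    and D: "\<And>i::nat. D i \<in> sets M" "disjoint_family D" "AE x in M. x \<in> (\<Union>i. D i)"
    and I: "I = D i\<^sub>0" "emeasure M I > 0"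
    and dom: "\<And>i. \<exists>C. \<forall>n. \<forall>A\<in>sets M. A \<subseteq> D i \<longrightarrow>
      (\<Sum>k<n. measure M ((f ^^ k) -` A \<inter> space M))
        \<le> C * measure M A * (\<Sum>k<n. measure M ((f ^^ k) -` I \<inter> space M))"
  shows "\<exists>\<mu>. sets \<mu> = sets M \<and> emeasure \<mu> (space M) \<noteq> 0 \<and> sigma_finite_measure \<mu> \<and>
    distr \<mu> \<mu> f = \<mu> \<and> absolutely_continuous M \<mu>"
proof -
  interpret prob_space M by fact
  have I_sets: "I \<in> sets M"
    using I D by simp
  define P where "P k A = (f ^^ k) -` A \<inter> space M" for k A
  have P_sets: "P k A \<in> sets M" if "A \<in> sets M" for k A
    unfolding P_def using measurable_compose_n[OF f] that by (rule measurable_sets)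
  have P_0: "P 0 A = A" if "A \<in> sets M" for A
    using sets.sets_into_space[OF that] by (auto simp: P_def)
  have P_Suc: "P k (P 1 A) = P (Suc k) A" for k A
    using measurable_space[OF measurable_compose_n[OF f]] by (auto simp: P_def)
  define S where "S n = (\<Sum>k<n. measure M (P k I))" for n
  define u where "u n A = (\<Sum>k<n. measure M (P k A)) / S n" for n A
  have S_nonneg: "0 \<le> S n" for n
    by (auto simp: S_def intro!: sum_nonneg)
  have S_mono: "S m \<le> S n" if "m \<le> n" for m n
    using that unfolding S_def by (intro sum_mono2) auto
  have "0 < measure M I"
    using I(2) by (simp add: emeasure_eq_measure)
  then have "0 < S 1"
    by (simp add: S_def P_0[OF I_sets])
  then have S_pos: "0 < S n" if "n \<ge> 1" for n
    using S_mono[OF that] by linarith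
  have "filterlim S at_top sequentially"
  proof -
    have "AE x in M. \<exists>\<^sub>F n in sequentially. x \<in> P n I"
      using AE_frequently_visits[OF f ac ec I_sets I(2)] AE_space
      by eventually_elim (simp add: P_def)
    then have *: "\<not> summable (\<lambda>n. measure M (P n I))"
      by (intro not_summable_if_AE_frequently finite_measure_axioms P_sets I_sets)
        (auto simp: emeasure_space_1)
    have "\<exists>n. Z \<le> S n" for Z
    proof (rule ccontr)
      assume "\<not> (\<exists>n. Z \<le> S n)"
      then have "(\<Sum>k<n. measure M (P k I)) \<le> Z" for n
        unfolding S_def[symmetric] by (meson linear)
      with * show False
        using summableI_nonneg_bounded[of "\<lambda>n. measure M (P n I)" Z] by simp
    qed
    then show ?thesis
      unfolding filterlim_at_top eventually_sequentially by (meson S_mono order_trans)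
  qed
  then have S_lim: "(\<lambda>n. 1 / S n) \<longlonglongrightarrow> 0"
    by (intro tendsto_divide_0[OF tendsto_const] filterlim_at_top_imp_at_infinity)
  have u_nonneg: "0 \<le> u n A" for n A
    by (auto simp: u_def S_nonneg intro!: divide_nonneg_nonneg sum_nonneg)
  have "\<exists>C. \<forall>n. \<forall>A\<in>sets M. A \<subseteq> D i \<longrightarrow> u n A \<le> C * measure M A" for i
  proof -
    obtain C where C: "\<And>n A. A \<in> sets M \<Longrightarrow> A \<subseteq> D i \<Longrightarrow>
        (\<Sum>k<n. measure M (P k A)) \<le> C * measure M A * S n"
      using dom[of i] unfolding P_def S_def by blast
    show ?thesis
    \<comment> \<open>For \<open>n = 0\<close> the quotient is 0 / 0 = 0, and a nonnegative constant
      covers this case too.\<close>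
    proof (intro exI[of _ "max C 0"] allI ballI impI)
      fix n A assume A: "A \<in> sets M" "A \<subseteq> D i"
      show "u n A \<le> max C 0 * measure M A"
      proof (cases "n = 0")
        case False
        then have "u n A \<le> C * measure M A"
          using C[OF A, of n] S_pos[of n] by (simp add: u_def divide_le_eq)
        also have "\<dots> \<le> max C 0 * measure M A"
          by (intro mult_right_mono) auto
        finally show ?thesis .
      qed (simp add: u_def)
    qed
  qed
  then obtain C where u_le: "\<And>n i A. A \<in> sets M \<Longrightarrow> A \<subseteq> D i \<Longrightarrow> u n A \<le> C i * measure M A"
    by metis
  \<comment> \<open>Bounds independent of \<open>n\<close> are known for sets inside a single piece,
    so limits are taken only there.\<close>
  define \<S> where "\<S> = {A \<in> sets M. \<exists>i. A \<subseteq> D i}"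
  have "bounded (range (\<lambda>n. u n A))" if "A \<in> \<S>" for A
    using that u_nonneg u_le unfolding \<S>_def bounded_iff by fastforce
  then obtain F L where F: "F \<noteq> bot" "F \<le> sequentially"
    and "\<And>A. A \<in> \<S> \<Longrightarrow> ((\<lambda>n. u n A) \<longlongrightarrow> L A) F"
    using pointwise_limit_along_finer_filter[of \<S> u] by blast
  then have L: "((\<lambda>n. u n A) \<longlongrightarrow> L A) F" if "A \<in> sets M" "A \<subseteq> D i" for A i
    using that by (auto simp: \<S>_def)
  have L_nonneg: "0 \<le> L A" if "A \<in> sets M" "A \<subseteq> D i" for A i
    by (rule tendsto_lowerbound[OF L[OF that]]) (auto simp: u_nonneg F)
  have L_le: "L A \<le> C i * measure M A" if "A \<in> sets M" "A \<subseteq> D i" for A i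
    by (rule tendsto_upperbound[OF L[OF that]]) (use u_le that F in auto)
  have u_add: "u n (A \<union> B) = u n A + u n B"
    if "A \<in> sets M" "B \<in> sets M" "A \<inter> B = {}" for n A B
  proof -
    have "measure M (P k (A \<union> B)) = measure M (P k A) + measure M (P k B)" for k
    proof -
      have "P k (A \<union> B) = P k A \<union> P k B" "P k A \<inter> P k B = {}"
        using that by (auto simp: P_def)
      then show ?thesis
        using that P_sets by (simp add: finite_measure_Union)
    qed
    then show ?thesis
      by (simp add: u_def sum.distrib add_divide_distrib)
  qed
  have L_add: "L (A \<union> B) = L A + L B"
    if "A \<in> sets M" "B \<in> sets M" "A \<inter> B = {}" "A \<subseteq> D i" "B \<subseteq> D i" for A B i
  proof (rule tendsto_unique[OF F(1)])
    show "((\<lambda>n. u n (A \<union> B)) \<longlongrightarrow> L (A \<union> B)) F"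
      using that by (intro L) auto
    show "((\<lambda>n. u n (A \<union> B)) \<longlongrightarrow> L A + L B) F"
      using that by (simp add: u_add) (intro tendsto_add L)
  qed
  have L_empty: "L {} = 0"
    using L_add[of "{}" "{}"] by simp
  \<comment> \<open>The normalisation gives \<open>u n I = 1\<close> from \<open>n = 1\<close> on,
    and this tail condition passes to the finer filter \<open>F\<close>. It makes \<mu> nonzero, and
    finite on \<open>I\<close>.\<close>
  have L_I: "L I = 1"
  proof (rule tendsto_unique[OF F(1)])
    show "((\<lambda>n. u n I) \<longlongrightarrow> L I) F"
      using L I_sets I by auto
    have "u n I = 1" if "n \<ge> 1" for n
      using S_pos[OF that] by (simp add: u_def flip: S_def)
    then have "\<forall>\<^sub>F n in sequentially. u n I = 1"
      by (auto simp: eventually_sequentially)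
    then show "((\<lambda>n. u n I) \<longlongrightarrow> 1) F"
      using F(2) by (intro tendsto_eventually) (auto simp: le_filter_def)
  qed

  \<comment> \<open>The limit measure as a sum over the pieces\<close>
  \<comment> \<open>Summing the limits over the pieces, instead of taking the limit of
    \<open>u n A\<close> for arbitrary \<open>A\<close>, secures countable additivity even when mass
    escapes through infinitely many pieces.\<close>
  define \<mu> where "\<mu> = measure_of (space M) (sets M) (\<lambda>A. \<Sum>i. ennreal (L (A \<inter> D i)))"
  have sets_\<mu>: "sets \<mu> = sets M" and sp_\<mu>: "space \<mu> = space M"
    by (simp_all add: \<mu>_def)
  have piece: "A \<inter> D i \<in> sets M" "A \<inter> D i \<subseteq> D i" if "A \<in> sets M" for A i
    using that D by auto
  have \<mu>: "emeasure \<mu> A = (\<Sum>i. ennreal (L (A \<inter> D i)))" if "A \<in> sets M" for A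
    unfolding \<mu>_def
  proof (rule emeasure_measure_of_sigma[OF _ _ _ that])
    show "sigma_algebra (space M) (sets M)" ..
    show "positive (sets M) (\<lambda>A. \<Sum>i. ennreal (L (A \<inter> D i)))"
      by (simp add: positive_def L_empty)
    show "countably_additive (sets M) (\<lambda>A. \<Sum>i. ennreal (L (A \<inter> D i)))"
    proof (rule countably_additiveI)
      fix A :: "nat \<Rightarrow> 'a set"
      assume A: "range A \<subseteq> sets M" "disjoint_family A" "(\<Union>i. A i) \<in> sets M"
      have *: "(\<Sum>j. ennreal (L (A j \<inter> D i))) = ennreal (L ((\<Union>j. A j) \<inter> D i))" for i
      proof -
        have "countably_additive (sets M) (\<lambda>A. ennreal (L (A \<inter> D i)))"
        \<comment> \<open>The maximum with 0 permits replacing the measure of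
          \<open>A \<inter> D i\<close> by that of \<open>A\<close> in the bound.\<close>
        proof (rule countably_additive_if_dominated[where C="max (C i) 0"])
          fix A B assume A: "A \<in> sets M"
          show "0 \<le> L (A \<inter> D i)"
            using L_nonneg piece[OF A] by blast
          have "L (A \<inter> D i) \<le> C i * measure M (A \<inter> D i)"
            using L_le piece[OF A] by blast
          also have "\<dots> \<le> max (C i) 0 * measure M A"
            using A D by (intro mult_mono finite_measure_mono) auto
          finally show "L (A \<inter> D i) \<le> max (C i) 0 * measure M A" .
          assume B: "B \<in> sets M" "A \<inter> B = {}"
          have "L ((A \<inter> D i) \<union> (B \<inter> D i)) = L (A \<inter> D i) + L (B \<inter> D i)"
            using piece[OF A] piece[OF B(1)] B(2) by (intro L_add) auto
          then show "L ((A \<union> B) \<inter> D i) = L (A \<inter> D i) + L (B \<inter> D i)"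
            by (simp add: Int_Un_distrib2)
        qed
        then show ?thesis
          using A unfolding countably_additive_def by blast
      qed
      \<comment> \<open>The double series is rearranged by reading the sum over the pieces as an
        integral for the counting measure.\<close>
      have "(\<Sum>j. \<Sum>i. ennreal (L (A j \<inter> D i))) = (\<Sum>i. \<Sum>j. ennreal (L (A j \<inter> D i)))"
        unfolding nn_integral_count_space_nat[symmetric, of "\<lambda>i. ennreal (L (_ \<inter> D i))"]
          nn_integral_count_space_nat[symmetric, of "\<lambda>i. \<Sum>j. ennreal (L (A j \<inter> D i))"]
        by (intro nn_integral_suminf[symmetric]) auto
      then show "(\<Sum>j. \<Sum>i. ennreal (L (A j \<inter> D i))) = (\<Sum>i. ennreal (L ((\<Union>j. A j) \<inter> D i)))"
        by (simp add: *)
    qed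
  qed
  have \<mu>_piece: "emeasure \<mu> A = ennreal (L A)" if A: "A \<in> sets M" "A \<subseteq> D i" for A i
  proof -
    have "A \<inter> D j = {}" if "j \<noteq> i" for j
      using A(2) D(2) that by (auto simp: disjoint_family_on_def)
    then have "(\<Sum>j. ennreal (L (A \<inter> D j))) = (\<Sum>j\<in>{i}. ennreal (L (A \<inter> D j)))"
      by (intro suminf_finite) (auto simp: L_empty)
    then show ?thesis
      using A by (simp add: \<mu> Int_absorb2)
  qed
  have ac_\<mu>: "absolutely_continuous M \<mu>"
    unfolding absolutely_continuous_def
  proof
    fix N assume N: "N \<in> null_sets M"
    have "L (N \<inter> D i) = 0" for i
    proof -
      have N': "N \<inter> D i \<in> sets M" "N \<inter> D i \<subseteq> D i"
        using N piece by auto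
      have "N \<inter> D i \<in> null_sets M"
        using N D(1) by (intro null_set_Int2)
      then have "measure M (N \<inter> D i) = 0"
        by (simp add: measure_def null_setsD1)
      then show ?thesis
        using L_le[OF N'] L_nonneg[OF N'] by simp
    qed
    then show "N \<in> null_sets \<mu>"
      using N by (simp add: null_sets_def sets_\<mu> \<mu>)
  qed
  define R where "R = space M - (\<Union>i. D i)"
  have R: "R \<in> sets M" "R \<in> null_sets M"
    using D(1,3) AE_iff_null_sets[of R M]
    by (auto simp: R_def null_sets_def elim!: AE_E_prob)
  have sf: "sigma_finite_measure \<mu>"
  proof
    show "\<exists>\<A>. countable \<A> \<and> \<A> \<subseteq> sets \<mu> \<and> \<Union>\<A> = space \<mu> \<and> (\<forall>a\<in>\<A>. emeasure \<mu> a \<noteq> \<infinity>)"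
    \<comment> \<open>The pieces need not cover the whole space; the remainder \<open>R\<close>,
      null for \<mu> by absolute continuity, completes the cover.\<close>
    proof (intro exI[of _ "insert R (range D)"] conjI)
      show "\<Union>(insert R (range D)) = space \<mu>"
        using D(1) sets.sets_into_space by (auto simp: R_def sp_\<mu>)
      have "emeasure \<mu> R = 0"
        using R ac_\<mu> by (auto simp: absolutely_continuous_def)
      then show "\<forall>a\<in>insert R (range D). emeasure \<mu> a \<noteq> \<infinity>"
        using \<mu>_piece[OF D(1) subset_refl] by auto
    qed (use R D in \<open>auto simp: sets_\<mu>\<close>)
  qed

  \<comment> \<open>Subinvariance of the limit measure\<close>
  have sub_piece: "emeasure \<mu> (P 1 A) \<le> ennreal (L A)" if A: "A \<in> sets M" "A \<subseteq> D i" for A i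
  proof -
    let ?B = "P 1 A"
    have B: "?B \<in> sets M"
      using A P_sets by blast
    \<comment> \<open>Shifting time by one trades the term at 0 for the term at \<open>n\<close>,
      which is at most 1; after division by \<open>S n\<close> this error disappears in the
      limit.\<close>
    have u_B: "u n ?B \<le> u n A + 1 / S n" for n
    proof -
      have "(\<Sum>k<n. measure M (P k ?B)) + measure M (P 0 A) = (\<Sum>k<Suc n. measure M (P k A))"
        unfolding P_Suc by (subst sum.lessThan_Suc_shift) simp
      then have "(\<Sum>k<n. measure M (P k ?B)) \<le> (\<Sum>k<n. measure M (P k A)) + measure M (P n A)"
        using measure_nonneg[of M "P 0 A"] unfolding sum.lessThan_Suc by linarith
      also have "\<dots> \<le> (\<Sum>k<n. measure M (P k A)) + 1"
        by simp
      finally show ?thesis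
        unfolding u_def add_divide_distrib[symmetric] by (rule divide_right_mono) (rule S_nonneg)
    qed
    \<comment> \<open>For finitely many pieces, sum and limit commute. Letting \<open>m\<close> grow
      afterwards yields only an inequality, as mass may leave every finite union.\<close>
    have "(\<Sum>j<m. L (?B \<inter> D j)) \<le> L A" for m
    proof (rule tendsto_le[OF F(1)])
      show "((\<lambda>n. \<Sum>j<m. u n (?B \<inter> D j)) \<longlongrightarrow> (\<Sum>j<m. L (?B \<inter> D j))) F"
        using piece[OF B] by (intro tendsto_sum L) auto
      have "((\<lambda>n. u n A + 1 / S n) \<longlongrightarrow> L A + 0) F"
        by (intro tendsto_add L[OF A] tendsto_mono[OF F(2) S_lim])
      then show "((\<lambda>n. u n A + 1 / S n) \<longlongrightarrow> L A) F"
        by simp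
      have "(\<Sum>j<m. u n (?B \<inter> D j)) \<le> u n ?B" for n
      proof -
        have "(\<Sum>j<m. u n (?B \<inter> D j)) = u n (\<Union>j<m. ?B \<inter> D j)"
        proof (induction m)
          case (Suc m)
          have "(\<Union>j<Suc m. ?B \<inter> D j) = (\<Union>j<m. ?B \<inter> D j) \<union> (?B \<inter> D m)"
            by (auto simp: less_Suc_eq)
          moreover have "D j \<inter> D m = {}" if "j < m" for j
            using D(2) that by (auto simp: disjoint_family_on_def)
          then have "(\<Union>j<m. ?B \<inter> D j) \<inter> (?B \<inter> D m) = {}"
            by blast
          then have "u n ((\<Union>j<m. ?B \<inter> D j) \<union> (?B \<inter> D m)) = u n (\<Union>j<m. ?B \<inter> D j) + u n (?B \<inter> D m)"
            using B D(1) by (intro u_add) auto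
          ultimately show ?case
            unfolding sum.lessThan_Suc Suc by metis
        qed (simp add: u_def P_def)
        also have "\<dots> \<le> u n (\<Union>j<m. ?B \<inter> D j) + u n (?B - (\<Union>j<m. ?B \<inter> D j))"
          using u_nonneg by simp
        also have "\<dots> = u n ((\<Union>j<m. ?B \<inter> D j) \<union> (?B - (\<Union>j<m. ?B \<inter> D j)))"
          using B D(1) by (intro u_add[symmetric]) auto
        also have "(\<Union>j<m. ?B \<inter> D j) \<union> (?B - (\<Union>j<m. ?B \<inter> D j)) = ?B"
          by auto
        finally show ?thesis .
      qed
      then show "\<forall>\<^sub>F n in F. (\<Sum>j<m. u n (?B \<inter> D j)) \<le> u n A + 1 / S n"
        using u_B by (intro always_eventually) (meson order_trans)
    qed
    then have "(\<Sum>j<m. ennreal (L (?B \<inter> D j))) \<le> ennreal (L A)" for m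
      using L_nonneg[OF piece[OF B]] by (simp add: ennreal_leI)
    then show ?thesis
      unfolding \<mu>[OF B] by (intro suminf_le_const summableI)
  qed
  have sub: "emeasure \<mu> (f -` A \<inter> space M) \<le> emeasure \<mu> A" if A: "A \<in> sets M" for A
  proof -
    \<comment> \<open>The part of the preimage lying over \<open>R\<close> is null because
      \<open>f\<close> pulls null sets back to null sets.\<close>
    let ?Z = "P 1 R"
    have "R \<in> null_sets (distr M M f)"
      using ac R by (auto simp: absolutely_continuous_def)
    then have "?Z \<in> null_sets M"
      using R f P_sets by (auto simp: null_sets_def emeasure_distr P_def)
    then have Z: "emeasure \<mu> ?Z = 0" "?Z \<in> sets \<mu>"
      using ac_\<mu> by (auto simp: absolutely_continuous_def)
    have "f -` A \<inter> space M = P 1 A"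
      by (simp add: P_def)
    also have "\<dots> \<subseteq> (\<Union>i. P 1 (A \<inter> D i)) \<union> ?Z"
      using measurable_space[OF f] by (auto simp: P_def R_def)
    finally have "emeasure \<mu> (f -` A \<inter> space M) \<le> emeasure \<mu> ((\<Union>i. P 1 (A \<inter> D i)) \<union> ?Z)"
      using P_sets[OF piece(1)[OF A]] Z by (intro emeasure_mono) (auto simp: sets_\<mu>)
    also have "\<dots> \<le> emeasure \<mu> (\<Union>i. P 1 (A \<inter> D i)) + emeasure \<mu> ?Z"
      using P_sets[OF piece(1)[OF A]] Z by (intro emeasure_subadditive) (auto simp: sets_\<mu>)
    also have "\<dots> \<le> (\<Sum>i. emeasure \<mu> (P 1 (A \<inter> D i)))"
      using P_sets[OF piece(1)[OF A]] Z emeasure_subadditive_countably[of "\<lambda>i. P 1 (A \<inter> D i)" \<mu>]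
      by (auto simp: sets_\<mu>)
    also have "\<dots> \<le> (\<Sum>i. ennreal (L (A \<inter> D i)))"
      by (intro suminf_le summableI sub_piece[OF piece[OF A]])
    finally show ?thesis
      by (simp add: \<mu>[OF A])
  qed
  have \<mu>_I: "emeasure \<mu> I = 1"
    using \<mu>_piece[of I i\<^sub>0] I I_sets L_I by simp
  have "emeasure \<mu> I < \<infinity>"
    unfolding \<mu>_I by simp
  then have "distr \<mu> \<mu> f = \<mu>"
    by (intro subinvariant_imp_invariant[OF sf sets_\<mu> f ac ec ac_\<mu> sub I_sets I(2)])
  moreover have "emeasure \<mu> I \<le> emeasure \<mu> (space M)"
    using I_sets sets.sets_into_space by (intro emeasure_mono) (auto simp: sets_\<mu>)
  then have "emeasure \<mu> (space M) \<noteq> 0"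
    by (auto simp: \<mu>_I)
  ultimately show ?thesis
    using sets_\<mu> sf ac_\<mu> by blast
qed

section \<open>Domination from bounded distortion\<close>

text \<open>Distortion bounds the preimages of \<open>A\<close> by those of \<open>J\<close>.
  Recurrence yields a time \<open>m\<close> at which a part of \<open>J\<close> of positive measure
  enters \<open>I\<close>, and distortion applied to this part bounds the preimages of
  \<open>J\<close> by those of \<open>I\<close>, delayed by \<open>m\<close>. The delay adds at most
  \<open>m\<close> to the sum, which is absorbed because a nonempty sum is at least the measure of
  \<open>I\<close>.\<close>

lemma dominated_averages_if_distortion:
  assumes "prob_space M" and f: "f \<in> M \<rightarrow>\<^sub>M M" and ec: "ergodic_conservative f M"
    and I: "I \<in> sets M" "emeasure M I > 0" and J: "J \<in> sets M" "emeasure M J > 0"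
    and pos: "\<And>n. 0 < emeasure M ((f ^^ n) -` J \<inter> space M)"
    and K: "K > 0" "\<And>n A. A \<in> sets M \<Longrightarrow> A \<subseteq> J \<Longrightarrow>
      1 / K * (measure M A / measure M J)
        \<le> measure M ((f ^^ n) -` A \<inter> space M) / measure M ((f ^^ n) -` J \<inter> space M) \<and>
      measure M ((f ^^ n) -` A \<inter> space M) / measure M ((f ^^ n) -` J \<inter> space M)
        \<le> K * (measure M A / measure M J)"
  shows "\<exists>C. \<forall>n. \<forall>A\<in>sets M. A \<subseteq> J \<longrightarrow>
    (\<Sum>k<n. measure M ((f ^^ k) -` A \<inter> space M))
      \<le> C * measure M A * (\<Sum>k<n. measure M ((f ^^ k) -` I \<inter> space M))"
proof -
  interpret prob_space M by fact
  define P where "P k A = (f ^^ k) -` A \<inter> space M" for k A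
  have P_sets: "P k A \<in> sets M" if "A \<in> sets M" for k A
    unfolding P_def using measurable_compose_n[OF f] that by (rule measurable_sets)
  have P_pos: "0 < measure M (P k J)" for k
    using pos[of k] by (simp add: emeasure_eq_measure P_def)
  have I_pos: "0 < measure M I" and J_pos: "0 < measure M J"
    using I J by (simp_all add: emeasure_eq_measure)
  define S where "S n = (\<Sum>k<n. measure M (P k I))" for n
  \<comment> \<open>If no \<open>m\<close> worked, almost every point of \<open>J\<close> would
    never reach \<open>I\<close>, against conservativity and the positive measure of
    \<open>J\<close>.\<close>
  obtain m where m: "measure M (J \<inter> P m I) > 0"
  proof (rule ccontr)
    assume *: "\<not> thesis"
    have "J \<inter> P m I \<in> null_sets M" for m
      using that[of m] * J P_sets[OF I(1)]
      by (auto simp: null_sets_def emeasure_eq_measure zero_less_measure_iff)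
    then have "AE x in M. x \<notin> J \<inter> P m I" for m
      by (rule AE_not_in)
    then have "AE x in M. \<forall>m. x \<notin> J \<inter> P m I"
      by (subst AE_all_countable) blast
    moreover have "AE x in M. \<exists>n\<ge>1. (f ^^ n) x \<in> I"
      using ec I by (simp add: ergodic_conservative_def)
    ultimately have "AE x in M. x \<notin> J"
      using AE_space by eventually_elim (auto simp: P_def)
    then have "J \<in> null_sets M"
      using AE_iff_null_sets[OF J(1)] by simp
    then show False
      using J(2) by auto
  qed
  let ?E = "J \<inter> P m I"
  have E: "?E \<in> sets M" "?E \<subseteq> J"
    using J P_sets[OF I(1)] by auto
  \<comment> \<open>The constant comes from the lower distortion bound for \<open>?E\<close>, solved
    for the measure of the preimage of \<open>J\<close>.\<close>
  define c where "c = K * measure M J / measure M ?E"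
  have c: "c > 0"
    using K(1) J_pos m by (simp add: c_def)
  have J_le: "measure M (P k J) \<le> c * measure M (P (k + m) I)" for k
  proof -
    have "measure M (P k J) \<le> c * measure M (P k ?E)"
      using K(2)[OF E, of k, folded P_def] K(1) J_pos m P_pos[of k]
      by (simp add: c_def field_simps)
    also have "P k ?E \<subseteq> P (k + m) I"
      by (auto simp: P_def funpow_add add.commute[of k])
    then have "measure M (P k ?E) \<le> measure M (P (k + m) I)"
      using P_sets[OF I(1)] by (rule finite_measure_mono)
    then have "c * measure M (P k ?E) \<le> c * measure M (P (k + m) I)"
      using c by simp
    finally show ?thesis .
  qed
  have shifted: "(\<Sum>k<n. measure M (P (k + m) I)) \<le> S n + m" for n
  proof -
    \<comment> \<open>The delayed window lies in the initial one of length \<open>n + m\<close>,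
      whose last \<open>m\<close> terms are at most 1 each.\<close>
    have "(\<Sum>k<n. measure M (P (k + m) I)) \<le> (\<Sum>k<n + m. measure M (P k I))"
      by (subst sum.reindex[symmetric, of "\<lambda>k. k + m", unfolded comp_def])
        (auto intro!: sum_mono2)
    also have "\<dots> = S n + (\<Sum>k=n..<n + m. measure M (P k I))"
      unfolding S_def lessThan_atLeast0 by (subst sum.atLeastLessThan_concat) auto
    also have "(\<Sum>k=n..<n + m. measure M (P k I)) \<le> (\<Sum>k=n..<n + m. 1)"
      by (intro sum_mono) auto
    finally show ?thesis
      by simp
  qed
  have I_le: "measure M I \<le> S n" if "n \<ge> 1" for n
  proof -
    have "(\<Sum>k<1. measure M (P k I)) \<le> S n"
      unfolding S_def using that by (intro sum_mono2) auto
    moreover have "P 0 I = I"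
      using sets.sets_into_space[OF I(1)] by (auto simp: P_def)
    ultimately show ?thesis
      by simp
  qed
  \<comment> \<open>The factors come in turn from the upper distortion bound on \<open>J\<close>,
    from the passage to \<open>I\<close>, and from
    \<open>S n + m \<le> S n * (1 + m / measure M I)\<close> for \<open>n \<ge> 1\<close>.\<close>
  define C where "C = K / measure M J * c * (1 + m / measure M I)"
  have "(\<Sum>k<n. measure M (P k A)) \<le> C * measure M A * S n"
    if A: "A \<in> sets M" "A \<subseteq> J" for n A
  proof (cases "n = 0")
    case False
    have "(\<Sum>k<n. measure M (P k A)) \<le> (\<Sum>k<n. K / measure M J * measure M A * (c * measure M (P (k + m) I)))"
    proof (rule sum_mono)
      fix k
      have "measure M (P k A) \<le> K / measure M J * measure M A * measure M (P k J)"
        using K(2)[OF A, of k, folded P_def] P_pos[of k]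
        by (simp add: divide_le_eq)
      also have "\<dots> \<le> K / measure M J * measure M A * (c * measure M (P (k + m) I))"
        using K(1) by (intro mult_left_mono J_le) auto
      finally show "measure M (P k A) \<le> K / measure M J * measure M A * (c * measure M (P (k + m) I))" .
    qed
    also have "\<dots> = K / measure M J * measure M A * c * (\<Sum>k<n. measure M (P (k + m) I))"
      by (simp add: sum_distrib_left mult.assoc)
    also have "\<dots> \<le> K / measure M J * measure M A * c * (S n + m)"
      using K(1) c by (intro mult_left_mono shifted) auto
    also have "\<dots> \<le> K / measure M J * measure M A * c * (S n + m * (S n / measure M I))"
      using K(1) c I_le[of n] I_pos False
      by (intro mult_left_mono add_left_mono) (auto simp: le_divide_eq mult_left_mono)
    also have "\<dots> = C * measure M A * S n"
      by (simp add: C_def field_simps)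
    finally show ?thesis .
  qed (simp add: S_def)
  then show ?thesis
    unfolding P_def S_def by blast
qed

section \<open>The partition as a sequence, and the conclusion\<close>

text \<open>Padding with empty sets turns a possibly finite partition into a family indexed by all
  naturals; indices outside the range of the enumeration get the empty union.\<close>

lemma countable_disjoint_enumeration:
  assumes "countable \<G>" "disjoint \<G>"
  obtains D :: "nat \<Rightarrow> 'a set" where "disjoint_family D" "\<G> \<subseteq> range D" "range D \<subseteq> insert {} \<G>"
proof
  define D where "D i = \<Union>{I \<in> \<G>. to_nat_on \<G> I = i}" for i
  have eq: "I = J" if "I \<in> \<G>" "J \<in> \<G>" "to_nat_on \<G> I = to_nat_on \<G> J" for I J
    using inj_on_to_nat_on[OF assms(1)] that by (simp add: inj_on_def)
  have D: "D (to_nat_on \<G> I) = I" if "I \<in> \<G>" for I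
    using eq that unfolding D_def by blast
  show "disjoint_family D"
    using assms(2) by (fastforce simp: disjoint_family_on_def D_def disjoint_def)
  show "\<G> \<subseteq> range D"
    using D by (metis rangeI subsetI)
  show "range D \<subseteq> insert {} \<G>"
  proof (rule image_subsetI)
    fix i
    show "D i \<in> insert {} \<G>"
    proof (cases "\<exists>I\<in>\<G>. to_nat_on \<G> I = i")
      case True
      then show ?thesis
        using D by auto
    qed (auto simp: D_def)
  qed
qed

theorem theoremA:
  fixes f :: "'a::topological_space \<Rightarrow> 'a" and \<Lambda> :: "'a measure"
  assumes "sigma_compact (UNIV :: 'a set)"
    and "sets \<Lambda> = sets borel" and "prob_space \<Lambda>"
    and "f \<in> borel \<rightarrow>\<^sub>M borel"
    and "absolutely_continuous \<Lambda> (distr \<Lambda> borel f)"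
    and "ergodic_conservative f \<Lambda>"
    and "locally_bounded_distortion f \<Lambda>"
  shows "\<exists>\<mu> :: 'a measure. sets \<mu> = sets borel \<and> emeasure \<mu> UNIV \<noteq> 0 \<and>
           sigma_finite_measure \<mu> \<and> invariant_measure f \<mu> \<and> absolutely_continuous \<Lambda> \<mu>"
proof -
  interpret prob_space \<Lambda> by fact
  note sets = assms(2) and ec = assms(6)
  have sp: "space \<Lambda> = UNIV"
    using sets_eq_imp_space_eq[OF sets] by simp
  have f: "f \<in> \<Lambda> \<rightarrow>\<^sub>M \<Lambda>"
    using assms(4) measurable_cong_sets[OF sets sets] by simp
  have "distr \<Lambda> borel f = distr \<Lambda> \<Lambda> f"
    by (rule distr_cong) (simp_all add: sets)
  then have ac: "absolutely_continuous \<Lambda> (distr \<Lambda> \<Lambda> f)"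
    using assms(5) by simp
  obtain \<G> where part: "measure_partition \<Lambda> \<G>" and dist: "\<And>J. J \<in> \<G> \<Longrightarrow> \<exists>K::real. K > 0 \<and>
         (\<forall>n::nat.
            0 < emeasure \<Lambda> ((f ^^ n) -` J \<inter> space \<Lambda>) \<and>
            emeasure \<Lambda> ((f ^^ n) -` J \<inter> space \<Lambda>) < \<infinity> \<and>
            (\<forall>A\<in>sets \<Lambda>. A \<subseteq> J \<longrightarrow>
               1 / K * (measure \<Lambda> A / measure \<Lambda> J)
                 \<le> measure \<Lambda> ((f ^^ n) -` A \<inter> space \<Lambda>) / measure \<Lambda> ((f ^^ n) -` J \<inter> space \<Lambda>) \<and>
               measure \<Lambda> ((f ^^ n) -` A \<inter> space \<Lambda>) / measure \<Lambda> ((f ^^ n) -` J \<inter> space \<Lambda>)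
                 \<le> K * (measure \<Lambda> A / measure \<Lambda> J)))"
    using assms(7) unfolding locally_bounded_distortion_def by blast
  have G: "countable \<G>" "disjoint \<G>" "emeasure \<Lambda> (space \<Lambda> - \<Union>\<G>) = 0"
    and G_sets: "\<And>J. J \<in> \<G> \<Longrightarrow> J \<in> sets \<Lambda>" and G_pos: "\<And>J. J \<in> \<G> \<Longrightarrow> 0 < emeasure \<Lambda> J"
    using part sets by (auto simp: measure_partition_def)
  \<comment> \<open>Otherwise the exceptional null set would be the whole space, of measure
    1.\<close>
  have "\<G> \<noteq> {}"
    using G(3) emeasure_space_1 by auto
  then obtain I where I: "I \<in> \<G>"
    by blast
  obtain D :: "nat \<Rightarrow> 'a set" where D: "disjoint_family D" "\<G> \<subseteq> range D" "range D \<subseteq> insert {} \<G>"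
    using countable_disjoint_enumeration[OF G(1,2)] .
  obtain i\<^sub>0 where i0: "I = D i\<^sub>0"
    using I D(2) by blast
  have UN_D: "(\<Union>i. D i) = \<Union>\<G>"
    using D by auto
  have D_sets: "D i \<in> sets \<Lambda>" for i
    using D(3) G_sets by (metis insert_iff range_subsetD sets.empty_sets)
  have "space \<Lambda> - \<Union>\<G> \<in> null_sets \<Lambda>"
    using G G_sets by (auto simp: null_sets_def)
  then have "AE x in \<Lambda>. x \<in> (\<Union>i. D i)"
    unfolding UN_D by (rule AE_I') auto
  moreover have "\<exists>C. \<forall>n. \<forall>A\<in>sets \<Lambda>. A \<subseteq> D i \<longrightarrow>
      (\<Sum>k<n. measure \<Lambda> ((f ^^ k) -` A \<inter> space \<Lambda>))
        \<le> C * measure \<Lambda> A * (\<Sum>k<n. measure \<Lambda> ((f ^^ k) -` I \<inter> space \<Lambda>))" for i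
  proof (cases "D i = {}")
    case False
    then have J: "D i \<in> \<G>"
      using D(3) by blast
    from dist[OF J] show ?thesis
      using dominated_averages_if_distortion[OF \<open>prob_space \<Lambda>\<close> f ec G_sets[OF I] G_pos[OF I]
          G_sets[OF J] G_pos[OF J]] by blast
  \<comment> \<open>A padding piece has only the empty set as a subset, for which any constant
    serves.\<close>
  qed auto
  ultimately obtain \<mu> where \<mu>: "sets \<mu> = sets \<Lambda>" "emeasure \<mu> (space \<Lambda>) \<noteq> 0"
      "sigma_finite_measure \<mu>" "distr \<mu> \<mu> f = \<mu>" "absolutely_continuous \<Lambda> \<mu>"
    using invariant_measure_if_dominated_averages[OF \<open>prob_space \<Lambda>\<close> f ac ec D_sets D(1) _ i0 G_pos[OF I]]
    by blast
  moreover have "f \<in> \<mu> \<rightarrow>\<^sub>M \<mu>"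
    using f measurable_cong_sets[OF \<mu>(1) \<mu>(1)] by simp
  ultimately show ?thesis
    unfolding invariant_measure_def by (metis sets sp)
qed

end
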